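(* Let $N$ be a positive integer, let $A_0,\dots,A_3,B_0,B_1,D_0,D_1,D_2,E,F_0,\dots,F_4,G_0,\dots,G_3$ be complex constants, and let $U,V$ be the $N\times N$ matrices given in the context. Suppose that either (i) $A_3=D_2=F_4=G_3=0$, or (ii) $A_0=A_1=B_0=D_0=F_0=F_1=F_2=G_0=G_1=0$. Then the $2N$ roots (with multiplicity) of the polynomial equation $\det(\lambda^2I+\lambda U+V)=0$ of degree $2N$ in $\lambda$ are $$\lambda_m^{(\pm)}=-\tfrac12\big\{E+(N-m)[D_1+(N-1-m)G_2]\pm\Delta_m\big\},\qquad m=1,\dots,N,$$ where $\Delta_m$ is a square root of $$\Delta_m^2=\{E+(N-m)[D_1+(N-1-m)G_2]\}^2+4m\big\{(2N-1-m)A_2+B_1+[3N^2-6N+2-3(N-1)m+m^2]F_3\big\}.$$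
   Context: $I$ is the $N\times N$ identity matrix and $\delta_{a,b}$ is the Kronecker symbol. For $m,n=1,\dots,N$, $$U_{mn}=(N+1-m)(N+2-m)G_0\delta_{n,m-2}+(N+1-m)[D_0+(N-m)G_1]\delta_{n,m-1}$$ $$+\{E+(N-m)[D_1+(N-1-m)G_2]\}\delta_{n,m}-m[D_2+(2N-3-m)G_3]\delta_{n,m+1},$$ $$V_{mn}=(N+3-m)(N+2-m)(N+1-m)F_0\delta_{n,m-3}+(N+2-m)(N+1-m)[A_0+(N-m)F_1]\delta_{n,m-2}$$ $$+(N+1-m)\{(N-m)[A_1+(N-1-m)F_2]+B_0\}\delta_{n,m-1}$$ $$-m\{(2N-1-m)A_2+B_1+[3N^2-6N+2-3(N-1)m+m^2]F_3\}\delta_{n,m}$$ $$+m(m+1)[A_3+(3N-5-m)F_4]\delta_{n,m+1}.$$ *)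

theory Defs
  imports
    "HOL-Computational_Algebra.Computational_Algebra"
    "Jordan_Normal_Form.Determinant"
begin

text \<open>
  Each indexed family of constants is a function on \<open>nat\<close>, e.g. \<open>A 0, A 1, A 2, A 3\<close>
  for $A_0,\dots,A_3$; values at larger indices are never used.
\<close>

definition kdelta :: "int \<Rightarrow> int \<Rightarrow> complex" where
  "kdelta a b = (if a = b then 1 else 0)"

text \<open>
  Rows and columns \<open>m, n\<close> in \<open>U_entry\<close> and \<open>V_entry\<close> are numbered from 1.  The
  Kronecker symbols are over \<open>int\<close>, so that \<open>m - 2\<close> and \<open>m - 3\<close> are not truncated at 0.
\<close>

definition U_entry ::
    "nat \<Rightarrow> (nat \<Rightarrow> complex) \<Rightarrow> complex \<Rightarrow> (nat \<Rightarrow> complex) \<Rightarrow> nat \<Rightarrow> nat \<Rightarrow> complex" where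
  "U_entry N D E G m n =
    (let \<nu> = of_nat N; \<mu> = of_nat m in
       (\<nu> + 1 - \<mu>) * (\<nu> + 2 - \<mu>) * G 0 * kdelta (int n) (int m - 2)
     + (\<nu> + 1 - \<mu>) * (D 0 + (\<nu> - \<mu>) * G 1) * kdelta (int n) (int m - 1)
     + (E + (\<nu> - \<mu>) * (D 1 + (\<nu> - 1 - \<mu>) * G 2)) * kdelta (int n) (int m)
     - \<mu> * (D 2 + (2 * \<nu> - 3 - \<mu>) * G 3) * kdelta (int n) (int m + 1))"

definition V_entry ::
    "nat \<Rightarrow> (nat \<Rightarrow> complex) \<Rightarrow> (nat \<Rightarrow> complex) \<Rightarrow> (nat \<Rightarrow> complex) \<Rightarrow> nat \<Rightarrow> nat \<Rightarrow> complex" where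
  "V_entry N A B F m n =
    (let \<nu> = of_nat N; \<mu> = of_nat m in
       (\<nu> + 3 - \<mu>) * (\<nu> + 2 - \<mu>) * (\<nu> + 1 - \<mu>) * F 0 * kdelta (int n) (int m - 3)
     + (\<nu> + 2 - \<mu>) * (\<nu> + 1 - \<mu>) * (A 0 + (\<nu> - \<mu>) * F 1) * kdelta (int n) (int m - 2)
     + (\<nu> + 1 - \<mu>) * ((\<nu> - \<mu>) * (A 1 + (\<nu> - 1 - \<mu>) * F 2) + B 0) * kdelta (int n) (int m - 1)
     - \<mu> * ((2 * \<nu> - 1 - \<mu>) * A 2 + B 1
            + (3 * \<nu>^2 - 6 * \<nu> + 2 - 3 * (\<nu> - 1) * \<mu> + \<mu>^2) * F 3) * kdelta (int n) (int m)
     + \<mu> * (\<mu> + 1) * (A 3 + (3 * \<nu> - 5 - \<mu>) * F 4) * kdelta (int n) (int m + 1))"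

definition U_mat :: "nat \<Rightarrow> (nat \<Rightarrow> complex) \<Rightarrow> complex \<Rightarrow> (nat \<Rightarrow> complex) \<Rightarrow> complex mat" where
  "U_mat N D E G = mat N N (\<lambda>(i, j). U_entry N D E G (i + 1) (j + 1))"

definition V_mat ::
    "nat \<Rightarrow> (nat \<Rightarrow> complex) \<Rightarrow> (nat \<Rightarrow> complex) \<Rightarrow> (nat \<Rightarrow> complex) \<Rightarrow> complex mat" where
  "V_mat N A B F = mat N N (\<lambda>(i, j). V_entry N A B F (i + 1) (j + 1))"

text \<open>
  \<open>quad_det U V\<close> is $\det(\lambda^2 I + \lambda U + V)$ as a polynomial in the
  indeterminate $\lambda$, which is \<open>[:0, 1:]\<close>.
\<close>

definition quad_det :: "complex mat \<Rightarrow> complex mat \<Rightarrow> complex poly" where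
  "quad_det U V =
     det ([:0, 1:]^2 \<cdot>\<^sub>m 1\<^sub>m (dim_row U) + [:0, 1:] \<cdot>\<^sub>m map_mat (\<lambda>c. [:c:]) U + map_mat (\<lambda>c. [:c:]) V)"

lemma poly_quad_det:
  assumes "U \<in> carrier_mat n n" "V \<in> carrier_mat n n"
  shows "poly (quad_det U V) z = det (z^2 \<cdot>\<^sub>m 1\<^sub>m n + z \<cdot>\<^sub>m U + V)"
proof -
  interpret comm_ring_hom "\<lambda>p. poly p z"
    by unfold_locales auto
  have "poly (quad_det U V) z = det (map_mat (\<lambda>p. poly p z)
     ([:0, 1:]^2 \<cdot>\<^sub>m 1\<^sub>m (dim_row U) + [:0, 1:] \<cdot>\<^sub>m map_mat (\<lambda>c. [:c:]) U + map_mat (\<lambda>c. [:c:]) V))"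
    unfolding quad_det_def by (rule hom_det[symmetric])
  also have "map_mat (\<lambda>p. poly p z)
     ([:0, 1:]^2 \<cdot>\<^sub>m 1\<^sub>m (dim_row U) + [:0, 1:] \<cdot>\<^sub>m map_mat (\<lambda>c. [:c:]) U + map_mat (\<lambda>c. [:c:]) V)
     = z^2 \<cdot>\<^sub>m 1\<^sub>m n + z \<cdot>\<^sub>m U + V"
    using assms by (intro eq_matI) auto
  finally show ?thesis .
qed

end

theory Submission
  imports Defs
begin

text \<open>
  Under (i) the matrix $\lambda^2 I + \lambda U + V$ is lower triangular, under (ii) it is upper
  triangular.  Either way its determinant is the product of its diagonal entries, which are monic
  quadratics in $\lambda$ with discriminants $\Delta_m^2$.
\<close>

text \<open>The body repeats that of \<open>quad_det\<close> verbatim, so that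
  \<open>quad_pencil_def[symmetric]\<close> can fold it there and carrier and entry facts
  apply.\<close>

definition quad_pencil :: "complex mat \<Rightarrow> complex mat \<Rightarrow> complex poly mat" where
  "quad_pencil U V =
     [:0, 1:]^2 \<cdot>\<^sub>m 1\<^sub>m (dim_row U) + [:0, 1:] \<cdot>\<^sub>m map_mat (\<lambda>c. [:c:]) U + map_mat (\<lambda>c. [:c:]) V"

lemma quad_pencil_carrier:
  assumes "U \<in> carrier_mat n n" "V \<in> carrier_mat n n"
  shows "quad_pencil U V \<in> carrier_mat n n"
  using assms by (auto simp: quad_pencil_def)

text \<open>The identity contributes to the leading coefficient only on the diagonal, so an
  off-diagonal entry is zero once \<open>U\<close> and \<open>V\<close> both vanish there, while
  diagonal entries are monic.\<close>

lemma quad_pencil_index: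
  assumes "U \<in> carrier_mat n n" "V \<in> carrier_mat n n" "i < n" "j < n"
  shows "quad_pencil U V $$ (i, j) = [:V $$ (i, j), U $$ (i, j), of_bool (i = j):]"
  using assms by (auto simp: quad_pencil_def power2_eq_square)

lemma quad_det_lower_triangular:
  assumes "U \<in> carrier_mat n n" "V \<in> carrier_mat n n"
    and "\<And>i j. i < j \<Longrightarrow> j < n \<Longrightarrow> U $$ (i, j) = 0"
    and "\<And>i j. i < j \<Longrightarrow> j < n \<Longrightarrow> V $$ (i, j) = 0"
  shows "quad_det U V = (\<Prod>i<n. [:V $$ (i, i), U $$ (i, i), 1:])"
proof -
  have "det (quad_pencil U V) = prod_list (diag_mat (quad_pencil U V))"
    using assms
    by (intro det_lower_triangular[OF _ quad_pencil_carrier[OF assms(1,2)]])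
       (auto simp: quad_pencil_index)
  then show ?thesis
    using assms quad_pencil_carrier[OF assms(1,2)]
    unfolding quad_det_def quad_pencil_def[symmetric]
    by (simp add: prod_list_diag_prod quad_pencil_index atLeast0LessThan)
qed

lemma quad_det_upper_triangular:
  assumes "U \<in> carrier_mat n n" "V \<in> carrier_mat n n"
    and "\<And>i j. j < i \<Longrightarrow> i < n \<Longrightarrow> U $$ (i, j) = 0"
    and "\<And>i j. j < i \<Longrightarrow> i < n \<Longrightarrow> V $$ (i, j) = 0"
  shows "quad_det U V = (\<Prod>i<n. [:V $$ (i, i), U $$ (i, i), 1:])"
proof -
  have "det (quad_pencil U V) = prod_list (diag_mat (quad_pencil U V))"
    using assms quad_pencil_carrier[OF assms(1,2)]
    by (intro det_upper_triangular[OF _ quad_pencil_carrier[OF assms(1,2)]])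
       (auto simp: quad_pencil_index)
  then show ?thesis
    using assms quad_pencil_carrier[OF assms(1,2)]
    unfolding quad_det_def quad_pencil_def[symmetric]
    by (simp add: prod_list_diag_prod quad_pencil_index atLeast0LessThan)
qed

text \<open>Solving the hypothesis for \<open>c\<close> reduces the claim to a difference of
  squares; either square root \<open>d\<close> of the discriminant will do. The double negation
  keeps each factor in the shape \<open>[:- r, 1:]\<close>.\<close>

lemma monic_quadratic_factor:
  fixes b c d :: "'a :: field_char_0"
  assumes "d^2 = b^2 - 4 * c"
  shows "[:c, b, 1:] = [:- (- (1/2) * (b + d)), 1:] * [:- (- (1/2) * (b - d)), 1:]"
proof -
  have "c = (b^2 - d^2) / 4"
    using assms by simp
  then show ?thesis
    by (simp add: field_simps power2_eq_square)
qed

lemma degree_prod_linear: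
  fixes r :: "'a \<Rightarrow> 'b :: idom"
  shows "degree (\<Prod>m\<in>S. [:- r m, 1:]) = card S"
  by (subst degree_prod_sum_eq) auto

text \<open>Each linear factor contributes a singleton. The multiset image keeps multiplicities when
  \<open>r\<close> is not injective; for infinite \<open>S\<close> both sides are empty.\<close>

lemma proots_prod_linear:
  fixes r :: "'a \<Rightarrow> 'b :: idom"
  shows "proots (\<Prod>m\<in>S. [:- r m, 1:]) = image_mset r (mset_set S)"
proof -
  have "proots (\<Prod>m\<in>S. [:- r m, 1:]) = (\<Sum>m\<in>S. {#r m#})"
    by (subst proots_prod) auto
  also have "\<dots> = image_mset r (mset_set S)"
    by (induction S rule: infinite_finite_induct) auto
  finally show ?thesis .
qed

theorem mainTheorem3:
  fixes N :: nat and A B D F G \<Delta> :: "nat \<Rightarrow> complex" and E :: complex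
  assumes "N > 0"
    and "(A 3 = 0 \<and> D 2 = 0 \<and> F 4 = 0 \<and> G 3 = 0) \<or>
         (A 0 = 0 \<and> A 1 = 0 \<and> B 0 = 0 \<and> D 0 = 0 \<and> F 0 = 0 \<and> F 1 = 0 \<and> F 2 = 0 \<and> G 0 = 0 \<and> G 1 = 0)"
    and "\<forall>m\<in>{1..N}. (\<Delta> m)^2 =
           (E + (of_nat N - of_nat m) * (D 1 + (of_nat N - 1 - of_nat m) * G 2))^2
           + 4 * of_nat m * ((2 * of_nat N - 1 - of_nat m) * A 2 + B 1
               + (3 * (of_nat N)^2 - 6 * of_nat N + 2
                  - 3 * (of_nat N - 1) * of_nat m + (of_nat m)^2) * F 3)"
  shows "degree (quad_det (U_mat N D E G) (V_mat N A B F)) = 2 * N \<and>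
         proots (quad_det (U_mat N D E G) (V_mat N A B F)) =
           {# - (1/2) * (E + (of_nat N - of_nat m) * (D 1 + (of_nat N - 1 - of_nat m) * G 2) + \<Delta> m).
              m \<in># mset_set {1..N} #}
         + {# - (1/2) * (E + (of_nat N - of_nat m) * (D 1 + (of_nat N - 1 - of_nat m) * G 2) - \<Delta> m).
              m \<in># mset_set {1..N} #}"
proof -
  define b where "b m = E + (of_nat N - of_nat m) * (D 1 + (of_nat N - 1 - of_nat m) * G 2)" for m :: nat
  \<comment> \<open>The sign is chosen so that the discriminant \<open>(b m)^2 - 4 * c m\<close> is
    the prescribed \<open>(\<Delta> m)^2\<close>.\<close>
  define c where "c m = - (of_nat m * ((2 * of_nat N - 1 - of_nat m) * A 2 + B 1
               + (3 * (of_nat N)^2 - 6 * of_nat N + 2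
                  - 3 * (of_nat N - 1) * of_nat m + (of_nat m)^2) * F 3))" for m :: nat
  define p where "p m = - (1/2) * (b m + \<Delta> m)" for m
  define q where "q m = - (1/2) * (b m - \<Delta> m)" for m
  let ?U = "U_mat N D E G" and ?V = "V_mat N A B F"
  have carr: "?U \<in> carrier_mat N N" "?V \<in> carrier_mat N N"
    by (simp_all add: U_mat_def V_mat_def)
  \<comment> \<open>Matrix positions start at 0, the entry formulas at 1, hence
    \<open>Suc i\<close>.\<close>
  have diag: "?U $$ (i, i) = b (Suc i)" "?V $$ (i, i) = c (Suc i)" if "i < N" for i
    using that by (simp_all add: U_mat_def V_mat_def U_entry_def V_entry_def kdelta_def b_def c_def Let_def)
  have "quad_det ?U ?V = (\<Prod>i<N. [:?V $$ (i, i), ?U $$ (i, i), 1:])"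
    using assms(2)
  proof
    assume "A 3 = 0 \<and> D 2 = 0 \<and> F 4 = 0 \<and> G 3 = 0"
    then show ?thesis
      \<comment> \<open>Above the diagonal only the symbol with \<open>n = m + 1\<close> survives,
        and the constants set to zero are exactly those in its coefficients.\<close>
      by (intro quad_det_lower_triangular[OF carr])
         (auto simp: U_mat_def V_mat_def U_entry_def V_entry_def kdelta_def Let_def)
  next
    assume "A 0 = 0 \<and> A 1 = 0 \<and> B 0 = 0 \<and> D 0 = 0 \<and> F 0 = 0 \<and> F 1 = 0 \<and> F 2 = 0 \<and> G 0 = 0 \<and> G 1 = 0"
    then show ?thesis
      \<comment> \<open>Below the diagonal only \<open>n = m - 1\<close>, \<open>m - 2\<close>,
        \<open>m - 3\<close> occur, and their coefficients now all vanish.\<close>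
      by (intro quad_det_upper_triangular[OF carr])
         (auto simp: U_mat_def V_mat_def U_entry_def V_entry_def kdelta_def Let_def)
  qed
  also have "\<dots> = (\<Prod>m\<in>{1..N}. [:c m, b m, 1:])"
    by (simp add: diag prod.atLeast1_atMost_eq)
  also have "\<dots> = (\<Prod>m\<in>{1..N}. [:- p m, 1:] * [:- q m, 1:])"
  proof (rule prod.cong)
    fix m assume "m \<in> {1..N}"
    then have "(\<Delta> m)^2 = (b m)^2 - 4 * c m"
      using assms(3) by (simp add: b_def c_def)
    from monic_quadratic_factor[OF this]
    show "[:c m, b m, 1:] = [:- p m, 1:] * [:- q m, 1:]"
      by (simp only: p_def q_def)
  qed simp
  also have "\<dots> = (\<Prod>m\<in>{1..N}. [:- p m, 1:]) * (\<Prod>m\<in>{1..N}. [:- q m, 1:])"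
    by (rule prod.distrib)
  finally have det: "quad_det ?U ?V = \<dots>" .
  \<comment> \<open>Degrees add and root multisets unite only for nonzero factors.\<close>
  have nz: "(\<Prod>m\<in>{1..N}. [:- r m, 1:]) \<noteq> 0" for r :: "nat \<Rightarrow> complex"
    by simp
  have "degree (quad_det ?U ?V) = 2 * N"
    unfolding det by (simp only: degree_mult_eq[OF nz nz] degree_prod_linear) simp
  moreover have "proots (quad_det ?U ?V) =
      image_mset p (mset_set {1..N}) + image_mset q (mset_set {1..N})"
    unfolding det by (simp only: proots_mult[OF nz nz] proots_prod_linear)
  ultimately show ?thesis
    by (simp only: p_def[abs_def] q_def[abs_def] b_def)
qed

end
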